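(* For each real number $\lambda$ with $1<\lambda<2$, there exists a transcendental meromorphic function $f$ in the complex plane $\mathbb{C}$ of logarithmic order $\lambda$, i.e. $\limsup_{r\to+\infty}\frac{\log T(r,f)}{\log\log r}=\lambda$, such that $f$ has no Julia direction.
   Context: A meromorphic function in $\mathbb{C}$ is transcendental if it is not a rational function; it then has an essential singularity at $\infty$ (in the sense that it does not extend meromorphically to $\infty$). $T(r,f)$ denotes the Nevanlinna characteristic function of a meromorphic function $f$ in $\mathbb{C}$. The logarithmic order of a positive increasing function $\phi(r)$ on $(0,+\infty)$ is $\limsup_{r\to+\infty}\frac{\log\phi(r)}{\log\log r}$, and the logarithmic order of $f$ is the logarithmic order of $T(r,f)$. Julia direction: for $0\le\theta<2\pi$, the ray $\Delta(\theta)=\{re^{i\theta}: r\ge 0\}$ is called a Julia direction for $f$ if, for every $\varepsilon>0$, in the angular region $\theta-\varepsilon<\arg z<\theta+\varepsilon$ the function $f$ assumes, infinitely often, every value of the extended complex plane $\mathbb{C}\cup\{\infty\}$ with at most two exceptions. *)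

theory Defs
  imports
    "HOL-Complex_Analysis.Complex_Analysis"
    "HOL-Computational_Algebra.Polynomial"
begin

(* Meromorphic functions in the plane are represented by functions f with
   "f nicely_meromorphic_on UNIV": removable singularities are filled in, and at a pole f takes
   the library's dummy value 0. The actual value there, infinity, is restored by sphere_value. *)

definition rational_function :: "(complex \<Rightarrow> complex) \<Rightarrow> bool" where
  "rational_function f \<longleftrightarrow>
     (\<exists>p q :: complex poly. q \<noteq> 0 \<and> (\<forall>z. poly q z \<noteq> 0 \<longrightarrow> f z = poly p z / poly q z))"

definition transcendental_meromorphic :: "(complex \<Rightarrow> complex) \<Rightarrow> bool" where
  "transcendental_meromorphic f \<longleftrightarrow> f nicely_meromorphic_on UNIV \<and> \<not> rational_function f"

(* The extended complex plane is rendered as complex option, with None as the point at infinity. *)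

definition sphere_value :: "(complex \<Rightarrow> complex) \<Rightarrow> complex \<Rightarrow> complex option" where
  "sphere_value f z = (if is_pole f z then None else Some (f z))"

(* n(r, f): the number of poles in the closed disc of radius r, with multiplicity. The sum is over
   a finite set by finite_poles_in_disc below. *)

definition pole_count :: "(complex \<Rightarrow> complex) \<Rightarrow> real \<Rightarrow> nat" where
  "pole_count f r = (\<Sum>z | norm z \<le> r \<and> is_pole f z. nat (- zorder f z))"

lemma finite_poles_in_disc:
  assumes "f nicely_meromorphic_on UNIV"
  shows "finite {z. norm z \<le> r \<and> is_pole f z}"
proof -
  have "f meromorphic_on UNIV"
    using assms unfolding nicely_meromorphic_on_def by blast
  then have "eventually (\<lambda>z. \<not> is_pole f z) (cosparse UNIV)"
    by (rule meromorphic_on_imp_not_pole_cosparse)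
  then have "{z. is_pole f z} sparse_in UNIV"
    by (simp add: eventually_cosparse)
  then have "{z. is_pole f z} sparse_in cball 0 r"
    by (rule sparse_in_subset) simp
  then have "finite (cball 0 r \<inter> {z. is_pole f z})"
    by (rule sparse_in_compact_finite) simp
  then show ?thesis
    by (simp add: Int_def)
qed

definition log_plus :: "real \<Rightarrow> real" where
  "log_plus x = max 0 (ln x)"

definition proximity_function :: "(complex \<Rightarrow> complex) \<Rightarrow> real \<Rightarrow> real" where
  "proximity_function f r =
     1 / (2 * pi) * integral {0..2 * pi} (\<lambda>t. log_plus (norm (f (of_real r * cis t))))"

definition counting_function :: "(complex \<Rightarrow> complex) \<Rightarrow> real \<Rightarrow> real" where
  "counting_function f r =
     integral {0..r} (\<lambda>t. (real (pole_count f t) - real (pole_count f 0)) / t)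
       + real (pole_count f 0) * ln r"

definition nevanlinna_T :: "(complex \<Rightarrow> complex) \<Rightarrow> real \<Rightarrow> real" where
  "nevanlinna_T f r = proximity_function f r + counting_function f r"

(* The upper limit is taken in the extended reals, since it may be infinite. *)

definition logarithmic_order :: "(real \<Rightarrow> real) \<Rightarrow> ereal" where
  "logarithmic_order \<phi> = Limsup at_top (\<lambda>r. ereal (ln (\<phi> r) / ln (ln r)))"

definition angular_region :: "real \<Rightarrow> real \<Rightarrow> complex set" where
  "angular_region \<alpha> \<beta> = {of_real r * cis t | r t. r > 0 \<and> \<alpha> < t \<and> t < \<beta>}"

definition Julia_direction :: "(complex \<Rightarrow> complex) \<Rightarrow> real \<Rightarrow> bool" where
  "Julia_direction f \<theta> \<longleftrightarrow>
     (\<forall>\<epsilon>>0. \<exists>E :: complex option set. finite E \<and> card E \<le> 2 \<and>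
        (\<forall>a. a \<notin> E \<longrightarrow> infinite {z \<in> angular_region (\<theta> - \<epsilon>) (\<theta> + \<epsilon>). sphere_value f z = a}))"

end

theory Submission
  imports Defs "HOL-Real_Asymp.Real_Asymp"
begin

text \<open>
  The function is the quotient of two canonical products whose zeros are mirror images,
  \<open>f z = (\<Prod>n. (1 - z / a\<^sub>n) / (1 + z / a\<^sub>n))\<close>,
  with positive real \<open>a\<^sub>n\<close> that at least double at each step. Two features of \<open>f\<close> rule out Julia
  directions. Each factor has modulus at most \<open>1\<close> in the right half-plane, and
  \<open>f (-z) = 1 / f z\<close>; so a sector that avoids the imaginary axis lies in one of the regions
  \<open>|f| \<le> 1\<close> and \<open>|f| \<ge> 1\<close>, and \<open>f\<close> omits a whole open set there. Along the imaginary axis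
  \<open>|f| = 1\<close>, and this persists approximately in a narrow sector around it: the modulus of the
  \<open>n\<close>-th factor differs from \<open>1\<close> by an amount of order \<open>|Re z| / |z|\<close> times
  \<open>\<rho>\<^sub>n / (1 + \<rho>\<^sub>n\<^sup>2)\<close>, where \<open>\<rho>\<^sub>n = |z| / a\<^sub>n\<close>, and lacunarity bounds the sum of the latter
  uniformly in \<open>z\<close> (\<open>kernel_sum_le\<close>). Hence \<open>|f| \<ge> 1/2\<close> in such a sector
  (\<open>half_le_norm_quot\<close>), and again an open set of values is omitted.

  The order comes from the poles. They are simple, and the counting function is
  \<open>\<Sum> ln (r / a\<^sub>n)\<close> over the \<open>a\<^sub>n \<le> r\<close>, which lies between constant multiples of
  \<open>n(r) ln r\<close> for regularly growing \<open>n(r)\<close>. The proximity function is of smaller order, at most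
  a constant times \<open>n(2 r) + 1\<close>, because a factor with \<open>a\<^sub>n \<le> 2 r\<close> is bounded by
  \<open>1 / |cos (t/2)|\<close> at argument \<open>t\<close>, whose logarithm is integrable, while the product of the other
  factors is bounded. Choosing \<open>a\<^sub>n = exp ((n + 1) powr (1 / (\<lambda> - 1)))\<close> makes \<open>n(r)\<close> the integer part
  of \<open>(ln r) powr (\<lambda> - 1)\<close>, so that \<open>T(r, f)\<close> grows like \<open>(ln r) powr \<lambda>\<close>. The exponent
  \<open>1 / (\<lambda> - 1)\<close> is at least \<open>1\<close> for \<open>\<lambda> < 2\<close>, which is what lacunarity requires.
\<close>

section \<open>Elementary inequalities\<close>

text \<open>
  With \<open>h x = x / (1 + x)\<close>, halving the argument already costs
  \<open>h x - h (x/2) = (x/2) / ((1 + x) (1 + x/2))\<close>, which is comparable to \<open>x / (1 + x\<^sup>2)\<close>. Summed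
  along a sequence that shrinks at least by half at each step, the right-hand side telescopes.
\<close>
lemma kernel_telescope:
  fixes x y :: real
  assumes "0 \<le> y" "2 * y \<le> x"
  shows "x / (1 + x\<^sup>2) \<le> 4 * (x / (1 + x) - y / (1 + y))"
proof -
  define h where "h = x / 2"
  have h: "x = 2 * h" "0 \<le> h" using assms by (auto simp: h_def)
  have "y / (1 + y) \<le> h / (1 + h)"
    using assms h by (simp add: divide_simps) (simp add: algebra_simps)
  moreover have "x / (1 + x\<^sup>2) \<le> 4 * (x / (1 + x) - h / (1 + h))"
  proof -
    have "4 * (x / (1 + x) - h / (1 + h)) = 4 * h / ((1 + 2 * h) * (1 + h))"
      unfolding h using h(2) by (simp add: divide_simps) (simp add: algebra_simps)
    moreover have "2 * h / (1 + (2 * h)\<^sup>2) \<le> 4 * h / ((1 + 2 * h) * (1 + h))"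
    proof -
      have "h * ((1 + 2 * h) * (1 + h)) \<le> h * (2 * (1 + (2 * h)\<^sup>2))"
      proof (rule mult_left_mono)
        have "0 \<le> 6 * (h - 1/4)\<^sup>2 + 5/8" by simp
        then show "(1 + 2 * h) * (1 + h) \<le> 2 * (1 + (2 * h)\<^sup>2)"
          by (simp add: power2_eq_square algebra_simps)
      qed fact
      then have "2 * h * ((1 + 2 * h) * (1 + h)) \<le> 4 * h * (1 + (2 * h)\<^sup>2)"
        by linarith
      moreover have "0 < (1 + 2 * h) * (1 + h)" "0 < 1 + (2 * h)\<^sup>2"
        using h(2) by (auto intro!: add_pos_nonneg mult_pos_pos)
      ultimately show ?thesis 
        by (simp only: pos_divide_le_eq times_divide_eq_left pos_le_divide_eq)
    qed
    ultimately show ?thesis using h(1) by simp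
  qed
  moreover have "4 * (x / (1 + x) - h / (1 + h)) \<le> 4 * (x / (1 + x) - y / (1 + y))"
    by (intro mult_left_mono diff_left_mono) (use calculation(1) in auto)
  ultimately show ?thesis by (meson order.trans)
qed

lemma prod_one_minus_ge_one_minus_sum:
  fixes u :: "nat \<Rightarrow> real"
  assumes "\<And>n. 0 \<le> u n" "\<And>n. u n \<le> 1"
  shows "1 - (\<Sum>n<N. u n) \<le> (\<Prod>n<N. 1 - u n)"
proof (induction N)
  case (Suc N)
  have P: "(\<Prod>n<N. 1 - u n) \<le> 1" using assms by (intro prod_le_1) auto
  have "u N * (\<Prod>n<N. 1 - u n) \<le> u N" using mult_left_mono[OF P assms(1)[of N]] by simp
  then show ?case using Suc by (simp add: algebra_simps)
qed auto

lemma norm_one_minus_sq: "(norm (1 - w))\<^sup>2 = 1 + (norm w)\<^sup>2 - 2 * Re w"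
  unfolding cmod_power2 by (simp add: power2_eq_square algebra_simps)

lemma norm_one_plus_sq: "(norm (1 + w))\<^sup>2 = 1 + (norm w)\<^sup>2 + 2 * Re w"
  unfolding cmod_power2 by (simp add: power2_eq_square algebra_simps)

text \<open>
  This rests on the identity
  \<open>|1 + \<rho> e\<^sup>i\<^sup>t|\<^sup>2 = (1 + \<rho>)\<^sup>2 cos\<^sup>2 (t/2) + (1 - \<rho>)\<^sup>2 sin\<^sup>2 (t/2)\<close>. The resulting bound
  \<open>1 / |cos (t/2)|\<close> for the Moebius map \<open>(1 - w) / (1 + w)\<close> does not depend on the modulus of \<open>w\<close>.
\<close>
lemma cos_half_times_norm_le:
  assumes "\<rho> \<ge> 0"
  shows "\<bar>cos (t / 2)\<bar> * norm (1 - of_real \<rho> * cis t) \<le> norm (1 + of_real \<rho> * cis t)"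
proof (rule order.trans)
  have "norm (1 - of_real \<rho> * cis t) \<le> 1 + \<rho>"
    using norm_triangle_ineq4[of 1 "of_real \<rho> * cis t"] assms by (simp add: norm_mult)
  then show "\<bar>cos (t / 2)\<bar> * norm (1 - of_real \<rho> * cis t) \<le> \<bar>cos (t / 2)\<bar> * (1 + \<rho>)"
    by (intro mult_left_mono) auto
  have c: "cos t = 2 * (cos (t/2))\<^sup>2 - 1"
    using cos_double_cos[of "t/2"] by simp
  have "(norm (1 + of_real \<rho> * cis t))\<^sup>2 - (\<bar>cos (t / 2)\<bar> * (1 + \<rho>))\<^sup>2
      = (1 - \<rho>)\<^sup>2 * (1 - (cos (t/2))\<^sup>2)"
  proof -
    have *: "(norm (of_real \<rho> * cis t))\<^sup>2 = \<rho>\<^sup>2" "Re (of_real \<rho> * cis t) = \<rho> * cos t"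
      by (simp_all add: norm_mult)
    show ?thesis
      unfolding norm_one_plus_sq * c power_mult_distrib power2_abs by algebra
  qed
  also have "\<dots> \<ge> 0"
    by (intro mult_nonneg_nonneg) (auto simp: abs_square_le_1)
  finally have le: "(\<bar>cos (t / 2)\<bar> * (1 + \<rho>))\<^sup>2 \<le> (norm (1 + of_real \<rho> * cis t))\<^sup>2"
    by (simp only: diff_ge_0_iff_ge)
  show "\<bar>cos (t / 2)\<bar> * (1 + \<rho>) \<le> norm (1 + of_real \<rho> * cis t)"
    by (rule power2_le_imp_le[OF le norm_ge_zero])
qed

lemma half_abs_le_abs_sin:
  fixes x :: real
  assumes "\<bar>x\<bar> \<le> pi / 2"
  shows "\<bar>x\<bar> / 2 \<le> \<bar>sin x\<bar>"
proof -
  have "\<bar>sin x - x\<bar> \<le> \<bar>x\<bar> ^ 3 / 6"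
    using Maclaurin_sin_bound[of x 3]
    by (simp add: eval_nat_numeral sin_coeff_def lessThan_Suc field_simps)
  also have "\<bar>x\<bar> ^ 3 = \<bar>x\<bar> * \<bar>x\<bar>\<^sup>2" by (simp add: eval_nat_numeral)
  also have "\<dots> \<le> \<bar>x\<bar> * 3"
  proof (rule mult_left_mono)
    have "\<bar>x\<bar> \<le> 17/10" using assms pi_less_4 pi_approx by simp
    then have "\<bar>x\<bar>\<^sup>2 \<le> (17/10)\<^sup>2" by (rule power_mono) simp
    then show "\<bar>x\<bar>\<^sup>2 \<le> 3" by (simp add: power2_eq_square)
  qed simp
  finally show ?thesis by linarith
qed

text \<open>
  A logarithmic singularity is traded for a square-root one, whose primitive is again a square
  root and hence continuous at the singular point.
\<close>
lemma neg_ln_le_two_div_sqrt: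
  fixes y :: real
  assumes "0 < y"
  shows "- ln y \<le> 2 / sqrt y"
proof -
  have "- ln y = 2 * ln (1 / sqrt y)" using assms by (simp add: ln_div ln_sqrt)
  also have "ln (1 / sqrt y) \<le> 1 / sqrt y - 1" using assms by (intro ln_le_minus_one) auto
  finally show ?thesis using assms by simp
qed

text \<open>
  In Isabelle/HOL, \<open>sqrt\<close> is odd on the reals, so \<open>2 * sqrt (t - pi)\<close> is a primitive on both sides
  of the singularity at once.
\<close>
lemma has_integral_inverse_sqrt_dist:
  "((\<lambda>t. 1 / sqrt \<bar>t - pi\<bar>) has_integral 4 * sqrt pi) {0..2 * pi}"
proof -
  have "((\<lambda>t. 1 / sqrt \<bar>t - pi\<bar>) has_integral
          (\<lambda>t. 2 * sqrt (t - pi)) (2 * pi) - (\<lambda>t. 2 * sqrt (t - pi)) 0) {0..2 * pi}"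
  proof (rule fundamental_theorem_of_calculus_interior_strong[of "{pi}"])
    fix x assume "x \<in> {0<..<2 * pi} - {pi}"
    then have "x - pi \<noteq> 0" by simp
    then have d: "DERIV sqrt (x - pi) :> 1 / sqrt \<bar>x - pi\<bar> / 2"
      by (rule DERIV_real_sqrt_generic)
         (use real_sqrt_minus[of "pi - x"] in \<open>auto simp: inverse_eq_divide\<close>)
    have "((\<lambda>t. 2 * sqrt (t - pi)) has_real_derivative 2 * (1 / sqrt \<bar>x - pi\<bar> / 2 * 1)) (at x)"
      by (intro DERIV_cmult DERIV_chain2[where g = "\<lambda>t. t - pi", OF d])
         (auto intro!: derivative_eq_intros)
    then show "((\<lambda>t. 2 * sqrt (t - pi)) has_vector_derivative 1 / sqrt \<bar>x - pi\<bar>) (at x)"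
      by (simp add: has_real_derivative_iff_has_vector_derivative)
  qed (auto intro!: continuous_intros)
  then show ?thesis by (simp add: real_sqrt_minus)
qed

lemma neg_ln_cos_half_le:
  assumes "t \<in> {0..2 * pi}" "t \<noteq> pi"
  shows "cos (t / 2) \<noteq> 0" "- ln \<bar>cos (t / 2)\<bar> \<le> 4 * (1 / sqrt \<bar>t - pi\<bar>)"
proof -
  have "cos (t / 2) = - sin ((t - pi) / 2)" by (simp add: diff_divide_distrib sin_diff)
  moreover have "\<bar>(t - pi) / 2\<bar> \<le> pi / 2"
    using assms by (auto simp: abs_le_iff field_simps)
  ultimately have *: "\<bar>t - pi\<bar> / 4 \<le> \<bar>cos (t / 2)\<bar>"
    using half_abs_le_abs_sin[of "(t - pi) / 2"] by simp
  then show "cos (t / 2) \<noteq> 0" using assms by auto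
  have "- ln \<bar>cos (t / 2)\<bar> \<le> - ln (\<bar>t - pi\<bar> / 4)"
    using * assms \<open>cos (t / 2) \<noteq> 0\<close> by simp
  also have "\<dots> \<le> 2 / sqrt (\<bar>t - pi\<bar> / 4)" using assms by (intro neg_ln_le_two_div_sqrt) auto
  also have "\<dots> = 4 * (1 / sqrt \<bar>t - pi\<bar>)" by (simp add: real_sqrt_divide)
  finally show "- ln \<bar>cos (t / 2)\<bar> \<le> 4 * (1 / sqrt \<bar>t - pi\<bar>)" .
qed

section \<open>A criterion excluding Julia directions\<close>

text \<open>
  Since at most two exceptional values are allowed, an infinite set of finite values that are
  omitted in one sector is more than enough.
\<close>
lemma not_Julia_directionI:
  fixes f :: "complex \<Rightarrow> complex"
  assumes "0 < \<epsilon>" "infinite S"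
    and omit: "\<And>z. z \<in> angular_region (\<theta> - \<epsilon>) (\<theta> + \<epsilon>) \<Longrightarrow> \<not> is_pole f z \<Longrightarrow> f z \<notin> S"
  shows "\<not> Julia_direction f \<theta>"
proof
  assume "Julia_direction f \<theta>"
  then obtain E where E: "finite E"
    "\<And>v. v \<notin> E \<Longrightarrow> infinite {z \<in> angular_region (\<theta> - \<epsilon>) (\<theta> + \<epsilon>). sphere_value f z = v}"
    unfolding Julia_direction_def using \<open>0 < \<epsilon>\<close> by blast
  have "infinite (Some ` S)" using assms(2) by (simp add: finite_image_iff)
  then obtain s where s: "s \<in> S" "Some s \<notin> E"
    using E(1) by (metis finite_subset image_subset_iff)
  have "{z \<in> angular_region (\<theta> - \<epsilon>) (\<theta> + \<epsilon>). sphere_value f z = Some s} = {}"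
    using omit s(1) by (auto simp: sphere_value_def split: if_splits)
  with E(2)[OF s(2)] show False by simp
qed

lemma infinite_norm_greater: "infinite {s :: complex. c < norm s}"
proof -
  have "inj (\<lambda>n::nat. complex_of_real (\<bar>c\<bar> + 1 + real n))" by (auto simp: inj_def)
  moreover have "range (\<lambda>n::nat. complex_of_real (\<bar>c\<bar> + 1 + real n)) \<subseteq> {s. c < norm s}"
    by (auto simp del: of_real_add)
  ultimately show ?thesis using range_inj_infinite finite_subset by blast
qed

lemma infinite_norm_less: "infinite {s :: complex. norm s < c}" if "0 < c"
proof -
  have "{s :: complex. norm s < c} = ball 0 c" by (auto simp: ball_def)
  then show ?thesis using that by (metis ball_eq_empty finite_imp_not_open not_le open_ball)
qed

section \<open>Lacunary sequences\<close>

locale lacunary_sequence =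
  fixes a :: "nat \<Rightarrow> real"
  assumes pos: "0 < a n"
    and double: "2 * a n \<le> a (Suc n)"
begin

lemma strict_mono: "strict_mono a"
  unfolding strict_mono_Suc_iff using pos double by (smt (verit))

lemma inj: "inj a"
  using strict_mono by (rule strict_mono_imp_inj_on)

lemma growth: "2 ^ n * a 0 \<le> a n"
proof (induction n)
  case (Suc n)
  then show ?case using double[of n] by simp
qed simp

lemma at_top: "filterlim a at_top at_top"
proof (rule filterlim_at_top_mono)
  show "filterlim (\<lambda>n. a 0 * real n) at_top at_top"
    by (intro filterlim_tendsto_pos_mult_at_top[OF tendsto_const pos] filterlim_real_sequentially)
  show "eventually (\<lambda>n. a 0 * real n \<le> a n) at_top"
  proof (intro always_eventually allI)
    fix n
    have "a 0 * real n \<le> a 0 * 2 ^ n"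
      using of_nat_less_two_power[of n, where 'a = real] pos[of 0] by (intro mult_left_mono) auto
    then show "a 0 * real n \<le> a n" using growth[of n] by (simp add: mult.commute)
  qed
qed

lemma summable_ratio: "summable (\<lambda>n. r / a n)"
proof (rule summable_comparison_test')
  show "summable (\<lambda>n. \<bar>r\<bar> / a 0 * (1 / 2) ^ n)"
    by (intro summable_mult summable_geometric) simp
  show "norm (r / a n) \<le> \<bar>r\<bar> / a 0 * (1 / 2) ^ n" for n
  proof -
    have "norm (r / a n) = \<bar>r\<bar> / a n" using pos[of n] by simp
    also have "\<dots> \<le> \<bar>r\<bar> / (2 ^ n * a 0)"
      using growth[of n] pos by (intro divide_left_mono mult_pos_pos) auto
    finally show ?thesis by (simp add: power_one_over field_simps)
  qed
qed

lemma ratio_double: "2 * (r / a (Suc n)) \<le> r / a n" if "0 \<le> r"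
proof -
  have "2 * (r / a (Suc n)) = 2 * r / a (Suc n)" by simp
  also have "\<dots> \<le> 2 * r / (2 * a n)"
    using that pos double[of n] by (intro divide_left_mono) auto
  finally show ?thesis by simp
qed

text \<open>
  The constant is independent of \<open>r\<close>: the terms decay geometrically on both sides of the index
  where \<open>a n\<close> passes \<open>r\<close>.
\<close>
lemma kernel_sum_le: "(\<Sum>n<N. (r / a n) / (1 + (r / a n)\<^sup>2)) \<le> 4" if "0 \<le> r"
proof -
  define h where "h n = (r / a n) / (1 + r / a n)" for n
  have h: "0 \<le> h n" "h n \<le> 1" for n
    using that pos[of n] unfolding h_def by (auto simp: divide_simps add_nonneg_nonneg)
  have "(\<Sum>n<N. (r / a n) / (1 + (r / a n)\<^sup>2)) \<le> (\<Sum>n<N. 4 * (h n - h (Suc n)))"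
    unfolding h_def using that pos ratio_double
    by (intro sum_mono kernel_telescope) (auto simp: less_imp_le)
  also have "\<dots> = 4 * (h 0 - h N)"
    by (simp only: sum_distrib_left[symmetric] sum_lessThan_telescope')
  also have "\<dots> \<le> 4"
  proof -
    have "h 0 - h N \<le> 1" using h[of 0] h[of N] by linarith
    then show ?thesis by simp
  qed
  finally show ?thesis .
qed

lemma tail_sum_le: "(\<Sum>n=k..<N. r / a n) \<le> 2 * (r / a k)" if "0 \<le> r"
proof (cases "k \<le> N")
  case True
  have "(\<Sum>n=k..<N. r / a n) \<le> (\<Sum>n=k..<N. - (2 * (r / a (Suc n))) - (- (2 * (r / a n))))"
  proof (rule sum_mono)
    show "r / a n \<le> - (2 * (r / a (Suc n))) - (- (2 * (r / a n)))" for n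
      using ratio_double[OF that, of n] by linarith
  qed
  also have "\<dots> = 2 * (r / a k) - 2 * (r / a N)"
    using sum_Suc_diff'[OF True, of "\<lambda>n. - (2 * (r / a n))"] by simp
  also have "\<dots> \<le> 2 * (r / a k)" using that pos[of N] by simp
  finally show ?thesis .
qed (use that pos[of k] in simp)

section \<open>The quotient of mirrored canonical products\<close>

text \<open>
  A lacunary sequence has exponent of convergence zero, so genus zero suffices and the
  Weierstrass factors are the plain \<open>1 - z / a n\<close> and \<open>1 + z / a n\<close>.
\<close>
sublocale num: weierstrass_product "\<lambda>n. complex_of_real (a n)" "\<lambda>_. 0"
proof
  show "filterlim (\<lambda>n. complex_of_real (a n)) at_infinity at_top"
    by (rule filterlim_norm_at_top_imp_at_infinity) (use at_top pos in \<open>simp add: less_imp_le\<close>)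
qed (use pos summable_ratio in \<open>auto simp: less_imp_neq[OF pos, symmetric] less_imp_le\<close>)

sublocale den: weierstrass_product "\<lambda>n. - complex_of_real (a n)" "\<lambda>_. 0"
proof
  show "filterlim (\<lambda>n. - complex_of_real (a n)) at_infinity at_top"
    by (rule filterlim_norm_at_top_imp_at_infinity) (use at_top pos in \<open>simp add: less_imp_le\<close>)
qed (use num.summable_a_p in \<open>auto simp: less_imp_neq[OF pos, symmetric]\<close>)

definition quot :: "complex \<Rightarrow> complex" where
  "quot z = num.f z / den.f z"

lemma den_eq: "den.f z = num.f (- z)"
  unfolding num.f_def den.f_def by simp

lemma quot_minus: "quot (- z) = inverse (quot z)"
  by (simp add: quot_def den_eq)

lemma num_eq_0_iff: "num.f z = 0 \<longleftrightarrow> (\<exists>n. z = a n)"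
  by (auto simp: num.zero)

lemma den_eq_0_iff: "den.f z = 0 \<longleftrightarrow> (\<exists>n. z = - a n)"
  by (auto simp: den.zero)

lemma num_tendsto:
  fixes z :: complex
  shows "(\<lambda>N. \<Prod>n<N. norm (1 - z / a n)) \<longlonglongrightarrow> norm (num.f z)"
  using tendsto_norm[OF has_prod_imp_tendsto'[OF num.has_prod[of z]]]
  by (simp add: weierstrass_factor_def prod_norm)

lemma den_tendsto:
  fixes z :: complex
  shows "(\<lambda>N. \<Prod>n<N. norm (1 + z / a n)) \<longlonglongrightarrow> norm (den.f z)"
  using tendsto_norm[OF has_prod_imp_tendsto'[OF den.has_prod[of z]]]
  by (simp add: weierstrass_factor_def prod_norm)

section \<open>Bounds for the modulus in sectors\<close>

text \<open>
  A point of the right half-plane is closer to \<open>a n\<close> than to \<open>- a n\<close>.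
\<close>
lemma norm_quot_le_1:
  fixes z :: complex
  assumes "0 \<le> Re z"
  shows "norm (quot z) \<le> 1"
proof -
  have "norm (num.f z) \<le> norm (den.f z)"
  proof (rule LIMSEQ_le[OF num_tendsto den_tendsto], intro exI allI impI prod_mono conjI)
    fix n
    have "0 \<le> Re (z / a n)" using assms pos[of n] by simp
    then have "(norm (1 - z / a n))\<^sup>2 \<le> (norm (1 + z / a n))\<^sup>2"
      unfolding norm_one_minus_sq norm_one_plus_sq by linarith
    then show "norm (1 - z / a n) \<le> norm (1 + z / a n)"
      by (rule power2_le_imp_le[OF _ norm_ge_zero])
  qed auto
  then show ?thesis by (simp add: quot_def norm_divide divide_le_eq_1)
qed

text \<open>
  With \<open>w = z / a n\<close>, \<open>\<rho> = norm w\<close> and \<open>x = Re w\<close>, the squared modulus of the \<open>n\<close>-th factor is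
  \<open>(1 + \<rho>\<^sup>2 - 2 x) / (1 + \<rho>\<^sup>2 + 2 x)\<close>, hence at least \<open>1 - 4 \<bar>x\<bar> / (1 + \<rho>\<^sup>2)\<close>. In the sector
  \<open>\<bar>x\<bar> \<le> \<rho> / 32\<close>, so the loss of the \<open>n\<close>-th factor is at most the number \<open>u n\<close> of the proof, and
  \<open>kernel_sum_le\<close> bounds the total loss by \<open>4 / 8 = 1 / 2\<close>.
\<close>
lemma half_le_norm_quot:
  fixes z :: complex
  assumes Re: "\<bar>Re z\<bar> \<le> norm z / 32" and den: "den.f z \<noteq> 0"
  shows "1 / 2 \<le> norm (quot z)"
proof -
  define r where "r = norm z"
  \<comment> \<open>\<open>1 / 8 = 4 / 32\<close>, from the factor \<open>4\<close> in the loss and the opening \<open>1 / 32\<close> of the sector.\<close>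
  define u where "u n = (1 / 8) * ((r / a n) / (1 + (r / a n)\<^sup>2))" for n
  have r: "0 \<le> r" by (simp add: r_def)
  have u0: "0 \<le> u n" for n
    using r pos[of n] unfolding u_def by (intro mult_nonneg_nonneg divide_nonneg_nonneg) auto
  have u1: "u n \<le> 1" for n
  proof -
    have "0 < 1 + (r / a n)\<^sup>2" by (intro add_pos_nonneg) auto
    moreover have "(r / a n) \<le> 8 * (1 + (r / a n)\<^sup>2)"
    proof -
      have "0 \<le> 8 * (r / a n - 1/16)\<^sup>2 + 7" by simp
      then show ?thesis by (simp add: power2_eq_square algebra_simps)
    qed
    ultimately have "(r / a n) / (1 + (r / a n)\<^sup>2) \<le> 8" by (simp only: pos_divide_le_eq)
    then show ?thesis unfolding u_def by (rule mult_left_mono[THEN order.trans]) auto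
  qed
  have factor: "(1 - u n) * (norm (1 + z / a n))\<^sup>2 \<le> (norm (1 - z / a n))\<^sup>2" for n
  proof -
    define x where "x = Re (z / a n)"
    define \<rho> where "\<rho> = r / a n"
    have \<rho>: "0 \<le> \<rho>" using r pos[of n] by (simp add: \<rho>_def)
    have "norm (z / a n) = \<rho>" using pos[of n] by (simp add: \<rho>_def r_def norm_divide)
    then have n: "(norm (1 + z / a n))\<^sup>2 = 1 + \<rho>\<^sup>2 + 2 * x" "(norm (1 - z / a n))\<^sup>2 = 1 + \<rho>\<^sup>2 - 2 * x"
      by (simp_all only: norm_one_plus_sq norm_one_minus_sq x_def)
    have x: "\<bar>x\<bar> \<le> \<rho> / 32"
      using Re pos[of n] by (simp add: x_def \<rho>_def r_def abs_divide divide_right_mono divide_simps)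
    have u: "u n * (1 + \<rho>\<^sup>2) = \<rho> / 8"
    proof -
      define D where "D = 1 + \<rho>\<^sup>2"
      have "0 < D" unfolding D_def by (intro add_pos_nonneg) auto
      then show ?thesis unfolding u_def \<rho>_def[symmetric] D_def[symmetric] by simp
    qed
    have "(1 - u n) * (1 + \<rho>\<^sup>2 + 2 * x) \<le> 1 + \<rho>\<^sup>2 - 2 * x"
    proof -
      have "x * (4 - 2 * u n) \<le> \<bar>x\<bar> * (4 - 2 * u n)"
        using u1[of n] by (intro mult_right_mono) auto
      also have "\<dots> \<le> \<bar>x\<bar> * 4" using u0[of n] by (intro mult_left_mono) auto
      also have "\<dots> \<le> u n * (1 + \<rho>\<^sup>2)" unfolding u using x by simp
      finally have "x * (4 - 2 * u n) \<le> u n * (1 + \<rho>\<^sup>2)" .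
      then show ?thesis by (simp add: algebra_simps)
    qed
    then show ?thesis unfolding n .
  qed
  have "1 / 2 * (norm (den.f z))\<^sup>2 \<le> (norm (num.f z))\<^sup>2"
  proof (rule LIMSEQ_le)
    show "(\<lambda>N. 1 / 2 * (\<Prod>n<N. norm (1 + z / a n))\<^sup>2) \<longlonglongrightarrow> 1 / 2 * (norm (den.f z))\<^sup>2"
      by (intro tendsto_intros den_tendsto)
    show "(\<lambda>N. (\<Prod>n<N. norm (1 - z / a n))\<^sup>2) \<longlonglongrightarrow> (norm (num.f z))\<^sup>2"
      by (intro tendsto_intros num_tendsto)
    show "\<exists>N0. \<forall>N\<ge>N0. 1 / 2 * (\<Prod>n<N. norm (1 + z / a n))\<^sup>2 \<le> (\<Prod>n<N. norm (1 - z / a n))\<^sup>2"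
    proof (intro exI allI impI)
      fix N
      have "(\<Sum>n<N. u n) = (1 / 8) * (\<Sum>n<N. (r / a n) / (1 + (r / a n)\<^sup>2))"
        by (simp add: u_def sum_distrib_left)
      then have "1 / 2 \<le> 1 - (\<Sum>n<N. u n)"
        using kernel_sum_le[OF r, of N] by linarith
      also have "\<dots> \<le> (\<Prod>n<N. 1 - u n)"
        using u0 u1 by (rule prod_one_minus_ge_one_minus_sum)
      finally have "1 / 2 * (\<Prod>n<N. norm (1 + z / a n))\<^sup>2
          \<le> (\<Prod>n<N. 1 - u n) * (\<Prod>n<N. norm (1 + z / a n))\<^sup>2"
        by (intro mult_right_mono) auto
      also have "\<dots> = (\<Prod>n<N. (1 - u n) * (norm (1 + z / a n))\<^sup>2)"
        by (simp add: prod.distrib prod_power_distrib)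
      also have "\<dots> \<le> (\<Prod>n<N. (norm (1 - z / a n))\<^sup>2)"
        using factor u1 by (intro prod_mono) auto
      finally show "1 / 2 * (\<Prod>n<N. norm (1 + z / a n))\<^sup>2 \<le> (\<Prod>n<N. norm (1 - z / a n))\<^sup>2"
        by (simp add: prod_power_distrib)
    qed
  qed
  then have "1 / 2 \<le> (norm (quot z))\<^sup>2"
    using den by (simp add: quot_def norm_divide power_divide pos_le_divide_eq)
  then have "(1 / 2)\<^sup>2 \<le> (norm (quot z))\<^sup>2" by (simp add: power2_eq_square)
  then show ?thesis by (rule power2_le_imp_le) simp
qed

section \<open>Meromorphy, poles and transcendence\<close>

lemma num_nonzero_if_den_zero: "num.f z \<noteq> 0" if "den.f z = 0"
proof
  assume "num.f z = 0"
  with that obtain m n where "- a n = a m"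
    by (auto simp: num_eq_0_iff den_eq_0_iff)
  with pos[of m] pos[of n] show False by simp
qed

lemma quot_analytic: "quot analytic_on {z}" if "den.f z \<noteq> 0"
  unfolding quot_def[abs_def] using that by (intro analytic_intros num.analytic den.analytic) auto

lemma is_pole_quot_iff: "is_pole quot z \<longleftrightarrow> den.f z = 0"
proof
  show "den.f z = 0" if "is_pole quot z"
    using that quot_analytic analytic_at_imp_no_pole by blast
  assume 0: "den.f z = 0"
  then have "z \<in> range (\<lambda>n. - complex_of_real (a n))" by (simp add: den.zero)
  then have "isolated_zero den.f z" by (rule den.isolated_zero)
  then have "filterlim den.f (at 0) (at z)"
    by (auto simp: isolated_zero_def filterlim_at)
  moreover have "isCont num.f z"
    by (rule analytic_at_imp_isCont) (rule num.analytic)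
  ultimately show "is_pole quot z"
    unfolding quot_def[abs_def] using num_nonzero_if_den_zero[OF 0] by (intro is_pole_divide)
qed

lemma is_pole_quot_iff': "is_pole quot z \<longleftrightarrow> (\<exists>n. z = - a n)"
  by (simp add: is_pole_quot_iff den_eq_0_iff)

text \<open>
  At the zeros of the denominator, division by zero gives \<open>0\<close>, which is the value that
  \<open>nicely_meromorphic_on\<close> prescribes at a pole.
\<close>
lemma quot_nicely_meromorphic: "quot nicely_meromorphic_on UNIV"
  unfolding nicely_meromorphic_on_def
proof (intro conjI ballI)
  show "quot meromorphic_on UNIV"
    unfolding quot_def[abs_def]
    by (intro meromorphic_on_divide analytic_on_imp_meromorphic_on num.analytic den.analytic)
  show "is_pole quot z \<and> quot z = 0 \<or> quot \<midarrow>z\<rightarrow> quot z" for z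
  proof (cases "den.f z = 0")
    case True
    then show ?thesis by (simp add: is_pole_quot_iff) (simp add: quot_def)
  next
    case False
    then show ?thesis
      using analytic_at_imp_isCont[OF quot_analytic] by (auto simp: isCont_def)
  qed
qed

lemma zorder_quot_pole: "zorder quot (- complex_of_real (a n)) = -1"
proof -
  define z where "z = - complex_of_real (a n)"
  have den0: "den.f z = 0" by (auto simp: z_def den_eq_0_iff)
  have num0: "num.f z \<noteq> 0" using num_nonzero_if_den_zero[OF den0] .
  have ev_num: "eventually (\<lambda>w. num.f w \<noteq> 0) (at z)"
    using analytic_at_imp_isCont[OF num.analytic] num0 unfolding isCont_def
    by (rule tendsto_imp_eventually_ne)
  have "isolated_zero den.f z" by (rule den.isolated_zero) (simp add: z_def)
  then have ev_den: "eventually (\<lambda>w. den.f w \<noteq> 0) (at z)" by (simp add: isolated_zero_def)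
  have "zorder quot z = zorder num.f z - zorder den.f z"
    unfolding quot_def[abs_def] using ev_num ev_den
    by (intro zorder_divide analytic_on_imp_meromorphic_on num.analytic den.analytic
          eventually_frequently) auto
  moreover have "zorder num.f z = 0" by (rule zorder_eq_0I[OF num.analytic num0])
  moreover have "(\<lambda>n. - complex_of_real (a n)) -` {z} = {n}"
    using inj by (auto simp: z_def inj_eq)
  then have "zorder den.f z = 1" by (simp add: den.zorder)
  ultimately show ?thesis by (simp add: z_def)
qed

lemma quot_0: "quot 0 = 1"
  by (simp add: quot_def num.f_def den.f_def)

text \<open>
  A representation \<open>p / q\<close> would give \<open>p * q\<close> infinitely many roots, the points \<open>a n\<close>. Then
  \<open>p = 0\<close>, which contradicts the value \<open>1\<close> at the origin.
\<close>
lemma not_rational_quot: "\<not> rational_function quot"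
proof
  assume "rational_function quot"
  then obtain p q :: "complex poly" where q: "q \<noteq> 0"
    and eq: "\<And>z. poly q z \<noteq> 0 \<Longrightarrow> quot z = poly p z / poly q z"
    unfolding rational_function_def by blast
  have "poly (p * q) (a n) = 0" for n
  proof (cases "poly q (a n) = 0")
    case False
    have "quot (a n) = 0" by (auto simp: quot_def num_eq_0_iff)
    with eq[OF False] False show ?thesis by simp
  qed simp
  then have "range (\<lambda>n. complex_of_real (a n)) \<subseteq> {z. poly (p * q) z = 0}" by blast
  moreover have "infinite (range (\<lambda>n. complex_of_real (a n)))"
    using inj by (intro range_inj_infinite) (auto simp: inj_def)
  ultimately have "p * q = 0" using poly_roots_finite finite_subset by blast
  with q have "p = 0" by simp
  have "eventually (\<lambda>z. poly q z \<noteq> 0) (at 0)"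
    using islimpt_finite[OF poly_roots_finite[OF q]] by (simp add: islimpt_iff_eventually)
  then have "eventually (\<lambda>z. quot z = 0) (at 0)"
    by eventually_elim (simp add: eq \<open>p = 0\<close>)
  then have "quot \<midarrow>0\<rightarrow> 0" by (rule tendsto_eventually)
  moreover have "quot \<midarrow>0\<rightarrow> 1"
    using analytic_at_imp_isCont[OF quot_analytic[of 0]] quot_0
    by (simp add: isCont_def den.f_def)
  ultimately show False using LIM_unique by fastforce
qed

lemma transcendental_quot: "transcendental_meromorphic quot"
  unfolding transcendental_meromorphic_def
  using quot_nicely_meromorphic not_rational_quot by blast

section \<open>Absence of Julia directions\<close>

text \<open>
  The three cases are sectors in the right half-plane, in the left half-plane, and around the
  imaginary axis; the values omitted are those of large, of small and again of small modulus.
\<close>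
lemma not_Julia_direction_quot: "\<not> Julia_direction quot \<theta>"
proof -
  have near: "\<exists>\<epsilon>>0. \<forall>t. \<theta> - \<epsilon> < t \<and> t < \<theta> + \<epsilon> \<longrightarrow> cos t \<in> U" if "open U" "cos \<theta> \<in> U" for U
  proof -
    have "(cos \<longlongrightarrow> cos \<theta>) (nhds \<theta>)"
      using isCont_cos[of \<theta>] by (simp add: isCont_def tendsto_at_iff_tendsto_nhds)
    then have "eventually (\<lambda>t. cos t \<in> U) (nhds \<theta>)"
      using that by (rule topological_tendstoD)
    then obtain \<epsilon> where "\<epsilon> > 0" "\<And>t. dist t \<theta> < \<epsilon> \<Longrightarrow> cos t \<in> U"
      unfolding eventually_nhds_metric by blast
    then show ?thesis by (intro exI[of _ \<epsilon>]) (auto simp: dist_real_def abs_less_iff)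
  qed
  consider "cos \<theta> > 0" | "cos \<theta> < 0" | "cos \<theta> = 0" by linarith
  then show ?thesis
  proof cases
    case 1
    then obtain \<epsilon> where \<epsilon>: "\<epsilon> > 0" "\<And>t. \<theta> - \<epsilon> < t \<Longrightarrow> t < \<theta> + \<epsilon> \<Longrightarrow> cos t > 0"
      using near[of "{0<..}"] by auto
    show ?thesis
    proof (rule not_Julia_directionI[OF \<epsilon>(1) infinite_norm_greater[of 1]])
      fix z assume "z \<in> angular_region (\<theta> - \<epsilon>) (\<theta> + \<epsilon>)"
      then have "0 \<le> Re z" using \<epsilon>(2) by (auto simp: angular_region_def less_imp_le)
      then show "quot z \<notin> {s. 1 < norm s}" using norm_quot_le_1[of z] by simp
    qed
  next
    case 2
    then obtain \<epsilon> where \<epsilon>: "\<epsilon> > 0" "\<And>t. \<theta> - \<epsilon> < t \<Longrightarrow> t < \<theta> + \<epsilon> \<Longrightarrow> cos t < 0"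
      using near[of "{..<0}"] by auto
    show ?thesis
    proof (rule not_Julia_directionI[OF \<epsilon>(1) infinite_norm_less[of 1]])
      fix z assume z: "z \<in> angular_region (\<theta> - \<epsilon>) (\<theta> + \<epsilon>)" and np: "\<not> is_pole quot z"
      then have Re: "Re z < 0" using \<epsilon>(2) by (auto simp: angular_region_def mult_pos_neg)
      then have "norm (quot (- z)) \<le> 1" by (intro norm_quot_le_1) simp
      then have le: "inverse (norm (quot z)) \<le> 1" by (simp add: quot_minus norm_inverse)
      have "quot z \<noteq> 0"
      proof
        assume "quot z = 0"
        then have "num.f z = 0" using np by (simp add: quot_def is_pole_quot_iff)
        then obtain n where "z = a n" by (auto simp: num_eq_0_iff)
        with Re pos[of n] show False by simp
      qed
      with le show "quot z \<notin> {s. norm s < 1}" by (simp add: inverse_le_1_iff not_less)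
    qed simp
  next
    case 3
    then obtain \<epsilon> where \<epsilon>: "\<epsilon> > 0" "\<And>t. \<theta> - \<epsilon> < t \<Longrightarrow> t < \<theta> + \<epsilon> \<Longrightarrow> \<bar>cos t\<bar> < 1 / 32"
    proof -
      obtain \<epsilon> where "\<epsilon> > 0" "\<forall>t. \<theta> - \<epsilon> < t \<and> t < \<theta> + \<epsilon> \<longrightarrow> cos t \<in> {-1/32<..<1/32}"
        using near[of "{-1/32<..<1/32}"] 3 by auto
      then show ?thesis by (intro that[of \<epsilon>]) (auto simp: abs_if)
    qed
    show ?thesis
    proof (rule not_Julia_directionI[OF \<epsilon>(1) infinite_norm_less[of "1 / 2"]])
      fix z assume z: "z \<in> angular_region (\<theta> - \<epsilon>) (\<theta> + \<epsilon>)" and np: "\<not> is_pole quot z"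
      then obtain r t where "0 < r" "z = of_real r * cis t" "\<bar>cos t\<bar> < 1 / 32"
        using \<epsilon>(2) by (auto simp: angular_region_def)
      then have "\<bar>Re z\<bar> \<le> norm z / 32" by (simp add: norm_mult abs_mult)
      then have "1 / 2 \<le> norm (quot z)"
        using np by (intro half_le_norm_quot) (auto simp: is_pole_quot_iff)
      then show "quot z \<notin> {s. norm s < 1 / 2}" by simp
    qed simp
  qed
qed

section \<open>The Nevanlinna characteristic\<close>

definition count :: "real \<Rightarrow> nat" where
  "count r = card {n. a n \<le> r}"

lemma finite_le: "finite {n. a n \<le> r}"
proof -
  have "eventually (\<lambda>n. r < a n) at_top" using at_top by (simp add: filterlim_at_top_dense)
  then have "eventually (\<lambda>n. \<not> a n \<le> r) cofinite"
    by (simp add: not_le cofinite_eq_sequentially)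
  then show ?thesis by (simp add: eventually_cofinite)
qed

lemma le_iff_less_count: "a n \<le> r \<longleftrightarrow> n < count r"
proof
  assume "a n \<le> r"
  then have "{..n} \<subseteq> {n. a n \<le> r}"
    using strict_mono by (auto dest: strict_mono_leD intro: order.trans)
  then have "card {..n} \<le> count r" unfolding count_def by (rule card_mono[OF finite_le])
  then show "n < count r" by simp
next
  assume n: "n < count r"
  show "a n \<le> r"
  proof (rule ccontr)
    assume "\<not> a n \<le> r"
    then have "{m. a m \<le> r} \<subseteq> {..<n}"
      by (auto simp: not_le simp flip: strict_mono_less[OF strict_mono])
    then have "count r \<le> card {..<n}" unfolding count_def by (intro card_mono) auto
    with n show False by simp
  qed
qed

lemma pole_count_quot: "pole_count quot r = count r"
proof -
  have "pole_count quot r = (\<Sum>z | norm z \<le> r \<and> is_pole quot z. 1)"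
    unfolding pole_count_def
    by (intro sum.cong refl) (auto simp: is_pole_quot_iff' zorder_quot_pole)
  also have "{z. norm z \<le> r \<and> is_pole quot z} = (\<lambda>n. - complex_of_real (a n)) ` {n. a n \<le> r}"
    using pos by (auto simp: is_pole_quot_iff' less_imp_le)
  also have "(\<Sum>z\<in>\<dots>. 1) = count r"
    unfolding count_def using inj by (simp, intro card_image) (auto simp: inj_on_def inj_def)
  finally show ?thesis .
qed

text \<open>
  The pole at \<open>- a n\<close> contributes \<open>1 / t\<close> to the integrand from \<open>t = a n\<close> on.
\<close>
lemma counting_function_quot: "counting_function quot r = (\<Sum>n<count r. ln (r / a n))"
proof -
  have 0: "count 0 = 0" using le_iff_less_count[of _ 0] pos by (metis not_gr_zero not_le)
  have "((\<lambda>t. \<Sum>n<count r. if t \<in> {a n..r} then 1 / t else 0) has_integral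
          (\<Sum>n<count r. ln (r / a n))) {0..r}"
  proof (rule has_integral_sum)
    fix n assume "n \<in> {..<count r}"
    then have n: "a n \<le> r" by (simp add: le_iff_less_count)
    have "((\<lambda>t. 1 / t) has_integral ln r - ln (a n)) {a n..r}"
      using n pos[of n]
      by (intro fundamental_theorem_of_calculus)
         (auto intro!: derivative_eq_intros simp flip: has_real_derivative_iff_has_vector_derivative)
    then show "((\<lambda>t. if t \<in> {a n..r} then 1 / t else 0) has_integral ln (r / a n)) {0..r}"
      using n pos[of n] by (subst has_integral_restrict) (auto simp: ln_div)
  qed simp
  also have "?this \<longleftrightarrow> ((\<lambda>t. (real (pole_count quot t) - real (pole_count quot 0)) / t) has_integral
          (\<Sum>n<count r. ln (r / a n))) {0..r}"
  proof (rule has_integral_cong)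
    fix t assume t: "t \<in> {0..r}"
    have "{n \<in> {..<count r}. a n \<le> t} = {..<count t}"
      using t by (auto simp: le_iff_less_count[symmetric])
    then have "(\<Sum>n<count r. if a n \<le> t then 1 / t else 0) = real (count t) / t"
      by (simp add: sum.If_cases Int_def)
    then show "(\<Sum>n<count r. if t \<in> {a n..r} then 1 / t else 0)
        = (real (pole_count quot t) - real (pole_count quot 0)) / t"
      using t by (simp add: pole_count_quot 0)
  qed
  finally show ?thesis
    unfolding counting_function_def by (simp add: integral_unique pole_count_quot 0)
qed

text \<open>
  The factors with \<open>a n \<le> 2 * r\<close> are estimated by \<open>cos_half_times_norm_le\<close>. For the others
  \<open>\<rho> = r / a n < 1 / 2\<close>, so that each is at most \<open>exp (4 * \<rho>)\<close>, and these \<open>\<rho>\<close> have sum at most \<open>1\<close>.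
\<close>
lemma cos_power_norm_num_le:
  assumes "0 < r"
  shows "\<bar>cos (t / 2)\<bar> ^ count (2 * r) * norm (num.f (of_real r * cis t))
           \<le> exp 4 * norm (den.f (of_real r * cis t))"
proof (rule LIMSEQ_le)
  define z where "z = of_real r * cis t"
  define k where "k = count (2 * r)"
  define c where "c = \<bar>cos (t / 2)\<bar>"
  show "(\<lambda>N. \<bar>cos (t / 2)\<bar> ^ count (2 * r) * (\<Prod>n<N. norm (1 - z / a n)))
      \<longlonglongrightarrow> \<bar>cos (t / 2)\<bar> ^ count (2 * r) * norm (num.f (of_real r * cis t))"
    unfolding z_def by (intro tendsto_intros num_tendsto)
  show "(\<lambda>N. exp 4 * (\<Prod>n<N. norm (1 + z / a n))) \<longlonglongrightarrow> exp 4 * norm (den.f (of_real r * cis t))"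
    unfolding z_def by (intro tendsto_intros den_tendsto)
  have quotient: "z / a n = of_real (r / a n) * cis t" for n by (simp add: z_def)
  have near: "c * norm (1 - z / a n) \<le> norm (1 + z / a n)" for n
    unfolding c_def quotient using assms pos[of n] by (intro cos_half_times_norm_le) simp
  have far: "norm (1 - z / a n) \<le> exp (4 * (r / a n)) * norm (1 + z / a n)" if "k \<le> n" for n
  proof -
    define \<rho> where "\<rho> = r / a n"
    have "2 * r < a n" using that le_iff_less_count[of n "2 * r"] by (simp add: k_def)
    then have \<rho>: "0 \<le> \<rho>" "2 * \<rho> \<le> 1" using assms pos[of n] by (auto simp: \<rho>_def)
    have w: "norm (z / a n) = \<rho>"
      using assms pos[of n] by (simp add: z_def \<rho>_def norm_divide norm_mult)
    have "norm (1 - z / a n) \<le> 1 + \<rho>" using norm_triangle_ineq4[of 1 "z / a n"] w by simp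
    also have "\<dots> \<le> (1 + 4 * \<rho>) * (1 - \<rho>)"
    proof -
      have "\<rho> * (2 * \<rho>) \<le> \<rho> * 1" using \<rho> by (intro mult_left_mono)
      then show ?thesis by (simp add: algebra_simps)
    qed
    also have "\<dots> \<le> exp (4 * \<rho>) * norm (1 + z / a n)"
    proof (rule mult_mono)
      show "1 - \<rho> \<le> norm (1 + z / a n)" using norm_diff_ineq[of 1 "z / a n"] w by simp
    qed (use \<rho> exp_ge_add_one_self in auto)
    finally show ?thesis by (simp add: \<rho>_def)
  qed
  show "\<exists>N0. \<forall>N\<ge>N0. \<bar>cos (t / 2)\<bar> ^ count (2 * r) * (\<Prod>n<N. norm (1 - z / a n))
      \<le> exp 4 * (\<Prod>n<N. norm (1 + z / a n))"
  proof (intro exI allI impI)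
    fix N assume N: "k \<le> N"
    have split: "(\<Prod>n<N. g n) = (\<Prod>n<k. g n) * (\<Prod>n=k..<N. g n)" for g :: "nat \<Rightarrow> real"
      using N by (metis atLeast0LessThan le0 prod.atLeastLessThan_concat)
    have "c ^ k * (\<Prod>n<k. norm (1 - z / a n)) = (\<Prod>n<k. c * norm (1 - z / a n))"
      by (simp add: prod.distrib)
    also have "\<dots> \<le> (\<Prod>n<k. norm (1 + z / a n))"
      using near by (intro prod_mono) (auto simp: c_def)
    finally have A: "c ^ k * (\<Prod>n<k. norm (1 - z / a n)) \<le> (\<Prod>n<k. norm (1 + z / a n))" .
    have "(\<Prod>n=k..<N. norm (1 - z / a n)) \<le> (\<Prod>n=k..<N. exp (4 * (r / a n)) * norm (1 + z / a n))"
      using far by (intro prod_mono) auto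
    also have "\<dots> = exp (4 * (\<Sum>n=k..<N. r / a n)) * (\<Prod>n=k..<N. norm (1 + z / a n))"
      by (simp add: prod.distrib exp_sum[symmetric] sum_distrib_left)
    also have "\<dots> \<le> exp 4 * (\<Prod>n=k..<N. norm (1 + z / a n))"
    proof (rule mult_right_mono)
      have "2 * r < a k" using le_iff_less_count[of k "2 * r"] by (simp add: k_def)
      then have "2 * (r / a k) \<le> 1" using pos[of k] by simp
      then show "exp (4 * (\<Sum>n=k..<N. r / a n)) \<le> exp 4"
        using tail_sum_le[of r k N] assms by simp
    qed (simp add: prod_nonneg)
    finally have B: "(\<Prod>n=k..<N. norm (1 - z / a n)) \<le> exp 4 * (\<Prod>n=k..<N. norm (1 + z / a n))" .
    have "(c ^ k * (\<Prod>n<k. norm (1 - z / a n))) * (\<Prod>n=k..<N. norm (1 - z / a n))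
        \<le> (\<Prod>n<k. norm (1 + z / a n)) * (exp 4 * (\<Prod>n=k..<N. norm (1 + z / a n)))"
      by (intro mult_mono A B prod_nonneg) auto
    then show "\<bar>cos (t / 2)\<bar> ^ count (2 * r) * (\<Prod>n<N. norm (1 - z / a n))
      \<le> exp 4 * (\<Prod>n<N. norm (1 + z / a n))"
      unfolding split c_def[symmetric] k_def[symmetric] by (simp only: mult_ac)
  qed
qed

lemma log_plus_quot_le:
  assumes "0 < r" "t \<in> {0..2 * pi}" "t \<noteq> pi"
  shows "log_plus (norm (quot (of_real r * cis t)))
           \<le> 4 + 4 * real (count (2 * r)) * (1 / sqrt \<bar>t - pi\<bar>)"
proof -
  define z where "z = of_real r * cis t"
  define k where "k = count (2 * r)"
  define c where "c = \<bar>cos (t / 2)\<bar>"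
  have c: "0 < c" using neg_ln_cos_half_le(1)[OF assms(2,3)] by (simp add: c_def)
  have nonneg: "0 \<le> 4 + 4 * real k * (1 / sqrt \<bar>t - pi\<bar>)"
    by (intro add_nonneg_nonneg mult_nonneg_nonneg) auto
  have "ln (norm (quot z)) \<le> 4 + 4 * real k * (1 / sqrt \<bar>t - pi\<bar>)"
  proof (cases "quot z = 0")
    case False
    then have nz: "0 < norm (den.f z)" "0 < norm (num.f z)" by (auto simp: quot_def)
    have "c ^ k * norm (num.f z) \<le> exp 4 * norm (den.f z)"
      using cos_power_norm_num_le[OF assms(1), of t] by (simp add: z_def k_def c_def)
    then have "norm (quot z) \<le> exp 4 / c ^ k"
      using nz c by (simp add: quot_def norm_divide divide_simps mult_ac)
    then have "ln (norm (quot z)) \<le> ln (exp 4 / c ^ k)" using False c by simp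
    also have "\<dots> = 4 + real k * (- ln c)" using c by (simp add: ln_div ln_realpow)
    also have "\<dots> \<le> 4 + real k * (4 * (1 / sqrt \<bar>t - pi\<bar>))"
      unfolding c_def using neg_ln_cos_half_le(2)[OF assms(2,3)]
      by (intro add_left_mono mult_left_mono) auto
    finally show ?thesis by (simp add: mult_ac)
  qed (use nonneg in simp)
  then show ?thesis using nonneg by (simp add: log_plus_def z_def k_def)
qed

text \<open>
  A function that is not integrable has integral \<open>0\<close> by convention; this is compatible both with
  nonnegativity and with the upper bound below, and settles one case of each proof.
\<close>
lemma proximity_function_quot_nonneg: "0 \<le> proximity_function quot r"
proof -
  let ?g = "\<lambda>t. log_plus (norm (quot (of_real r * cis t)))"
  have "0 \<le> integral {0..2 * pi} ?g"
  proof (cases "?g integrable_on {0..2 * pi}")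
    case True
    then show ?thesis by (rule integral_nonneg) (simp add: log_plus_def)
  qed (simp add: not_integrable_integral)
  then show ?thesis unfolding proximity_function_def by simp
qed

lemma proximity_function_quot_le:
  assumes "0 < r"
  shows "proximity_function quot r \<le> 4 + 8 * real (count (2 * r))"
proof -
  let ?g = "\<lambda>t. log_plus (norm (quot (of_real r * cis t)))"
  define k where "k = real (count (2 * r))"
  define b where "b t = 4 + 4 * k * (1 / sqrt \<bar>t - pi\<bar>)" for t
  have "integral {0..2 * pi} ?g \<le> 8 * pi + 16 * k * sqrt pi"
  proof (cases "?g integrable_on {0..2 * pi}")
    case True
    \<comment> \<open>The dominating function is redefined at \<open>t = pi\<close>, where the circle may meet a pole and the
      estimate fails.\<close>
    have "(b has_integral (8 * pi + 4 * k * (4 * sqrt pi))) {0..2 * pi}"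
      unfolding b_def
      using has_integral_add[OF has_integral_const_real[of "4::real" 0 "2 * pi"]
          has_integral_mult_right[OF has_integral_inverse_sqrt_dist, of "4 * k"]]
      by (simp add: mult_ac)
    then have "((\<lambda>t. if t = pi then ?g pi else b t) has_integral (8 * pi + 4 * k * (4 * sqrt pi)))
                 {0..2 * pi}"
      by (rule has_integral_spike_finite[of "{pi}", rotated 2]) auto
    then have "integral {0..2 * pi} ?g \<le> 8 * pi + 4 * k * (4 * sqrt pi)"
      by (rule has_integral_le[OF integrable_integral[OF True]])
         (use log_plus_quot_le[OF assms] in \<open>auto simp: b_def k_def\<close>)
    then show ?thesis by simp
  qed (simp add: not_integrable_integral k_def)
  also have "\<dots> \<le> 8 * pi + 16 * k * pi"
  proof -
    have "sqrt pi \<le> pi" using pi_ge_two by (intro real_le_lsqrt) (auto simp: power2_eq_square)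
    then show ?thesis by (intro add_left_mono mult_left_mono) (auto simp: k_def)
  qed
  finally have "1 / (2 * pi) * integral {0..2 * pi} ?g \<le> 1 / (2 * pi) * (8 * pi + 16 * k * pi)"
    by (intro mult_left_mono) auto
  also have "\<dots> = 4 + 8 * k" by (simp add: field_simps)
  finally show ?thesis unfolding proximity_function_def k_def .
qed

lemma nevanlinna_T_quot_le:
  assumes "1 \<le> r" "1 \<le> a 0"
  shows "nevanlinna_T quot r \<le> real (count r) * ln r + 4 + 8 * real (count (2 * r))"
proof -
  have "1 \<le> a n" for n
    using assms(2) strict_mono_leD[OF strict_mono, of 0 n] by simp
  then have "counting_function quot r \<le> (\<Sum>n<count r. ln r)"
    unfolding counting_function_quot using assms pos
    by (intro sum_mono) (auto simp: ln_div)
  then show ?thesis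
    unfolding nevanlinna_T_def using proximity_function_quot_le[of r] assms by simp
qed

text \<open>
  Each pole of modulus at most \<open>sqrt r\<close> contributes at least \<open>ln r / 2\<close>.
\<close>
lemma nevanlinna_T_quot_ge:
  assumes "1 \<le> r"
  shows "real (count (sqrt r)) * (ln r / 2) \<le> nevanlinna_T quot r"
proof -
  have le: "sqrt r \<le> r" using assms by (intro real_le_lsqrt) (auto simp: power2_eq_square)
  have "real (count (sqrt r)) * (ln r / 2) = (\<Sum>n<count (sqrt r). ln r / 2)" by simp
  also have "\<dots> \<le> (\<Sum>n<count (sqrt r). ln (r / a n))"
  proof (rule sum_mono)
    fix n assume "n \<in> {..<count (sqrt r)}"
    then have "a n \<le> sqrt r" by (simp add: le_iff_less_count)
    then have "ln (a n) \<le> ln (sqrt r)" using assms pos[of n] by simp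
    then show "ln r / 2 \<le> ln (r / a n)" using assms pos[of n] by (simp add: ln_div ln_sqrt)
  qed
  also have "\<dots> \<le> (\<Sum>n<count r. ln (r / a n))"
  proof (rule sum_mono2)
    have "count (sqrt r) \<le> count r"
      unfolding count_def using le by (intro card_mono finite_le) auto
    then show "{..<count (sqrt r)} \<subseteq> {..<count r}" by simp
    fix n assume "n \<in> {..<count r} - {..<count (sqrt r)}"
    then have "a n \<le> r" by (simp add: le_iff_less_count)
    then show "0 \<le> ln (r / a n)" using pos[of n] by simp
  qed simp
  also have "\<dots> \<le> nevanlinna_T quot r"
    unfolding nevanlinna_T_def counting_function_quot
    using proximity_function_quot_nonneg[of r] by simp
  finally show ?thesis .
qed

text \<open>
  In terms of \<open>x = ln r\<close>, the characteristic lies between functions that are asymptotic to constant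
  multiples of \<open>x powr lam\<close>; the constants vanish in the quotient by \<open>ln x\<close>.
\<close>
lemma logarithmic_order_quot:
  assumes lam: "1 < lam" and a0: "1 \<le> a 0"
    and count: "\<And>r. 1 \<le> r \<Longrightarrow> (ln r) powr (lam - 1) - 1 \<le> real (count r)"
      "\<And>r. 1 \<le> r \<Longrightarrow> real (count r) \<le> (ln r) powr (lam - 1)"
  shows "logarithmic_order (nevanlinna_T quot) = ereal lam"
proof -
  define lo up where "lo x = ((x / 2) powr (lam - 1) - 1) * (x / 2)"
    and "up x = x powr (lam - 1) * x + 4 + 8 * (2 * x) powr (lam - 1)" for x
  have lower: "lo (ln r) \<le> nevanlinna_T quot r" and upper: "nevanlinna_T quot r \<le> up (ln r)"
    if r: "2 \<le> r" for r
  proof -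
    have "lo (ln r) = ((ln (sqrt r)) powr (lam - 1) - 1) * (ln r / 2)"
      using r by (simp add: lo_def ln_sqrt)
    also have "\<dots> \<le> real (count (sqrt r)) * (ln r / 2)"
      using r by (intro mult_right_mono count) auto
    also have "\<dots> \<le> nevanlinna_T quot r" using r by (intro nevanlinna_T_quot_ge) simp
    finally show "lo (ln r) \<le> nevanlinna_T quot r" .
    have "nevanlinna_T quot r \<le> real (count r) * ln r + 4 + 8 * real (count (2 * r))"
      using r a0 by (intro nevanlinna_T_quot_le) auto
    also have "\<dots> \<le> (ln r) powr (lam - 1) * ln r + 4 + 8 * (ln (2 * r)) powr (lam - 1)"
      using r by (intro add_mono mult_mono count order_refl) auto
    also have "\<dots> \<le> up (ln r)"
    proof -
      have "ln (2 * r) \<le> 2 * ln r" using r by (simp add: ln_mult)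
      then have "(ln (2 * r)) powr (lam - 1) \<le> (2 * ln r) powr (lam - 1)"
        using r lam by (intro powr_mono2) auto
      then show ?thesis by (simp add: up_def)
    qed
    finally show "nevanlinna_T quot r \<le> up (ln r)" .
  qed
  have "((\<lambda>r. ln (nevanlinna_T quot r) / ln (ln r)) \<longlongrightarrow> lam) at_top"
  proof (rule tendsto_sandwich)
    show "((\<lambda>r. ln (lo (ln r)) / ln (ln r)) \<longlongrightarrow> lam) at_top"
      unfolding lo_def using lam by real_asymp
    show "((\<lambda>r. ln (up (ln r)) / ln (ln r)) \<longlongrightarrow> lam) at_top"
      unfolding up_def using lam by real_asymp
    have lo_pos: "eventually (\<lambda>r. 0 < lo (ln r)) at_top"
      unfolding lo_def using lam by real_asymp
    have ll: "eventually (\<lambda>r::real. 0 < ln (ln r)) at_top" by real_asymp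
    show "eventually (\<lambda>r. ln (lo (ln r)) / ln (ln r) \<le> ln (nevanlinna_T quot r) / ln (ln r)) at_top"
      using lo_pos ll eventually_ge_at_top[of 2]
    proof eventually_elim
      case (elim r)
      show ?case using elim lower[of r] by (intro divide_right_mono) auto
    qed
    show "eventually (\<lambda>r. ln (nevanlinna_T quot r) / ln (ln r) \<le> ln (up (ln r)) / ln (ln r)) at_top"
      using lo_pos ll eventually_ge_at_top[of 2]
    proof eventually_elim
      case (elim r)
      show ?case using elim lower[of r] upper[of r] by (intro divide_right_mono) auto
    qed
  qed
  then have "((\<lambda>r. ereal (ln (nevanlinna_T quot r) / ln (ln r))) \<longlongrightarrow> ereal lam) at_top"
    by (intro tendsto_intros)
  then show ?thesis unfolding logarithmic_order_def by (intro lim_imp_Limsup) auto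
qed

end

section \<open>The sequence of prescribed logarithmic order\<close>

lemma powr_Suc_ge_powr_plus_1:
  fixes \<alpha> :: real
  assumes "1 \<le> \<alpha>" "1 \<le> x"
  shows "x powr \<alpha> + 1 \<le> (x + 1) powr \<alpha>"
proof -
  have "x powr \<alpha> + 1 \<le> x * (x + 1) powr (\<alpha> - 1) + (x + 1) powr (\<alpha> - 1)"
  proof (rule add_mono)
    have "x powr \<alpha> = x * x powr (\<alpha> - 1)" using assms by (simp add: powr_mult_base)
    also have "\<dots> \<le> x * (x + 1) powr (\<alpha> - 1)"
      using assms by (intro mult_left_mono powr_mono2) auto
    finally show "x powr \<alpha> \<le> x * (x + 1) powr (\<alpha> - 1)" .
    show "1 \<le> (x + 1) powr (\<alpha> - 1)" using assms by (intro ge_one_powr_ge_zero) auto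
  qed
  also have "\<dots> = (x + 1) * (x + 1) powr (\<alpha> - 1)" by (simp add: algebra_simps)
  also have "\<dots> = (x + 1) powr \<alpha>" using assms by (simp add: powr_mult_base)
  finally show ?thesis .
qed

theorem theorem1p1:
  fixes lam :: real
  assumes "1 < lam" and "lam < 2"
  shows "\<exists>f :: complex \<Rightarrow> complex.
           transcendental_meromorphic f \<and>
           logarithmic_order (nevanlinna_T f) = ereal lam \<and>
           \<not> (\<exists>\<theta>. 0 \<le> \<theta> \<and> \<theta> < 2 * pi \<and> Julia_direction f \<theta>)"
proof -
  define \<alpha> where "\<alpha> = 1 / (lam - 1)"
  define a where "a n = exp (real (Suc n) powr \<alpha>)" for n
  have \<alpha>: "1 \<le> \<alpha>" "\<alpha> * (lam - 1) = 1" using assms by (auto simp: \<alpha>_def)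
  interpret lacunary_sequence a
  proof
    show "0 < a n" for n by (simp add: a_def)
    show "2 * a n \<le> a (Suc n)" for n
    proof -
      have "2 * a n \<le> exp 1 * a n"
        using exp_ge_add_one_self[of 1] by (intro mult_right_mono) (auto simp: a_def)
      also have "\<dots> = exp (real (Suc n) powr \<alpha> + 1)" by (simp add: a_def exp_add)
      also have "\<dots> \<le> a (Suc n)"
        unfolding a_def using powr_Suc_ge_powr_plus_1[OF \<alpha>(1), of "real (Suc n)"]
        by (simp add: add.commute)
      finally show ?thesis .
    qed
  qed
  \<comment> \<open>The indices start at \<open>0\<close>, so the count is the integer part of \<open>(ln r) powr (lam - 1)\<close>.\<close>
  have count_iff: "n < count r \<longleftrightarrow> real (Suc n) \<le> (ln r) powr (lam - 1)" if "1 \<le> r" for n r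
  proof -
    have "n < count r \<longleftrightarrow> real (Suc n) powr \<alpha> \<le> ln r"
      unfolding le_iff_less_count[symmetric] a_def using that by (simp add: ln_ge_iff)
    also have "\<dots> \<longleftrightarrow> real (Suc n) \<le> (ln r) powr (lam - 1)"
    proof
      assume "real (Suc n) powr \<alpha> \<le> ln r"
      then have "(real (Suc n) powr \<alpha>) powr (lam - 1) \<le> (ln r) powr (lam - 1)"
        using assms by (intro powr_mono2) auto
      then show "real (Suc n) \<le> (ln r) powr (lam - 1)" by (simp add: powr_powr \<alpha>)
    next
      assume "real (Suc n) \<le> (ln r) powr (lam - 1)"
      then have "real (Suc n) powr \<alpha> \<le> ((ln r) powr (lam - 1)) powr \<alpha>"
        using \<alpha> by (intro powr_mono2) auto
      then show "real (Suc n) powr \<alpha> \<le> ln r"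
        using that \<alpha>(2) by (simp add: powr_powr mult.commute)
    qed
    finally show ?thesis .
  qed
  have "logarithmic_order (nevanlinna_T quot) = ereal lam"
  proof (rule logarithmic_order_quot)
    show "1 \<le> a 0" by (simp add: a_def)
    fix r :: real assume r: "1 \<le> r"
    show "(ln r) powr (lam - 1) - 1 \<le> real (count r)"
      using count_iff[OF r, of "count r"] by simp
    show "real (count r) \<le> (ln r) powr (lam - 1)"
      using count_iff[OF r, of "count r - 1"] by (cases "count r") auto
  qed fact
  then show ?thesis
    using transcendental_quot not_Julia_direction_quot by blast
qed
end
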